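(* Consider single-stage joint matching and pricing (no first-stage demand vertices and zero supply weights). Let $(x,y)$ be an optimal solution of the ex ante program (see context) with optimal value $\mathrm{EAR}$. The policy that offers each $i\in D_2$ the price $p_i=\mathcal T_i(y_i)$ and then outputs a maximum vertex-weighted matching between the accepting vertices (with weights $w_i(p_i)$) and $S$ has expected demand efficiency $\mathbb{E}\big[\sum_{i\in D_2}v_i\mathbf1\{v_i\ge p_i,\ i\text{ matched}\}\big]\ge(1-\frac1e)\,\mathrm{EAR}$.
   Context: A finite bipartite graph $G=(D_2,S,E)$; each $i\in D_2$ has a value $v_i\sim F_i$, independently, with $F_i$ known. A vertex offered price $p_i$ accepts iff $v_i\ge p_i$. Let $w_i(p)=\mathbb{E}_{v\sim F_i}[v\mid v\ge p]$ and $\mathcal T_i(q)=\arg\max\{t:1-F_i(t)\ge q\}$. The ex ante program is: maximize $\sum_{i\in D_2}w_i(\mathcal T_i(y_i))\,y_i$ subject to $y_i=\sum_{j\in N(i)}x_{ij}\le1$ ($i\in D_2$), $\sum_{i\in N(j)}x_{ij}\le1$ ($j\in S$), $x_{ij}\ge0$ ($(i,j)\in E$). *)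

theory Defs
  imports "HOL-Probability.Probability"
begin

text \<open>
  The threshold is taken in the extended reals: at \<open>q = 0\<close> every real price qualifies and the
  threshold is \<open>\<infinity>\<close>, a price that is never accepted; at \<open>q = 1\<close> it can be \<open>-\<infinity>\<close> if the distribution
  is unbounded below. The supremum is the same whether \<open>1 - F t\<close> is read as the probability of
  \<open>v > t\<close> or of \<open>v \<ge> t\<close>; in the second reading it is attained for every \<open>0 < q < 1\<close>.
\<close>
definition threshold :: "real measure \<Rightarrow> real \<Rightarrow> ereal" where
  "threshold F q = Sup (ereal ` {t. 1 - cdf F t \<ge> q})"

text \<open>Equals \<open>0\<close> when the conditioning event is null.\<close>
definition cond_value :: "real measure \<Rightarrow> ereal \<Rightarrow> real" where
  "cond_value F p = (LINT t:{t. p \<le> ereal t}|F. t) / measure F {t. p \<le> ereal t}"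

definition ex_ante_feasible ::
  "'i set \<Rightarrow> 's set \<Rightarrow> ('i \<times> 's) set \<Rightarrow> ('i \<Rightarrow> 's \<Rightarrow> real) \<Rightarrow> ('i \<Rightarrow> real) \<Rightarrow> bool" where
  "ex_ante_feasible D S E x y \<longleftrightarrow>
     (\<forall>i\<in>D. y i = (\<Sum>j\<in>{j\<in>S. (i, j) \<in> E}. x i j) \<and> y i \<le> 1) \<and>
     (\<forall>j\<in>S. (\<Sum>i\<in>{i\<in>D. (i, j) \<in> E}. x i j) \<le> 1) \<and>
     (\<forall>(i, j)\<in>E. 0 \<le> x i j)"

definition ex_ante_objective :: "('i \<Rightarrow> real measure) \<Rightarrow> 'i set \<Rightarrow> ('i \<Rightarrow> real) \<Rightarrow> real" where
  "ex_ante_objective F D y = (\<Sum>i\<in>D. cond_value (F i) (threshold (F i) (y i)) * y i)"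

definition ex_ante_optimal ::
  "('i \<Rightarrow> real measure) \<Rightarrow> 'i set \<Rightarrow> 's set \<Rightarrow> ('i \<times> 's) set
     \<Rightarrow> ('i \<Rightarrow> 's \<Rightarrow> real) \<Rightarrow> ('i \<Rightarrow> real) \<Rightarrow> bool" where
  "ex_ante_optimal F D S E x y \<longleftrightarrow>
     ex_ante_feasible D S E x y \<and>
     (\<forall>x' y'. ex_ante_feasible D S E x' y' \<longrightarrow>
        ex_ante_objective F D y' \<le> ex_ante_objective F D y)"

definition bip_matching :: "'i set \<Rightarrow> 's set \<Rightarrow> ('i \<times> 's) set \<Rightarrow> ('i \<times> 's) set \<Rightarrow> bool" where
  "bip_matching A S E M \<longleftrightarrow> M \<subseteq> E \<inter> (A \<times> S) \<and> inj_on fst M \<and> inj_on snd M"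

definition max_vertex_weighted_matching ::
  "'i set \<Rightarrow> 's set \<Rightarrow> ('i \<times> 's) set \<Rightarrow> ('i \<Rightarrow> real) \<Rightarrow> ('i \<times> 's) set \<Rightarrow> bool" where
  "max_vertex_weighted_matching A S E u M \<longleftrightarrow>
     bip_matching A S E M \<and>
     (\<forall>M'. bip_matching A S E M' \<longrightarrow> (\<Sum>i\<in>fst ` M'. u i) \<le> (\<Sum>i\<in>fst ` M. u i))"

definition accepting :: "'i set \<Rightarrow> ('i \<Rightarrow> ereal) \<Rightarrow> ('i \<Rightarrow> real) \<Rightarrow> 'i set" where
  "accepting D p val = {i\<in>D. p i \<le> ereal (val i)}"

text \<open>
  The policy observes only who accepts, so its matching rule \<open>mu\<close> maps the set of accepting
  vertices to a matching.
\<close>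
definition demand_efficiency ::
  "'w measure \<Rightarrow> ('i \<Rightarrow> 'w \<Rightarrow> real) \<Rightarrow> 'i set \<Rightarrow> ('i \<Rightarrow> ereal) \<Rightarrow> ('i set \<Rightarrow> ('i \<times> 's) set) \<Rightarrow> real"
  where
  "demand_efficiency P v D p mu =
     (LINT \<omega>|P. (\<Sum>i\<in>D. v i \<omega> *
        of_bool (p i \<le> ereal (v i \<omega>) \<and> i \<in> fst ` mu (accepting D p (\<lambda>k. v k \<omega>)))))"

end

theory Submission
  imports Defs
begin

text \<open>
  Let every accepting \<open>i\<close>, which accepts with probability \<open>a i \<ge> y i\<close>, propose to a neighbour \<open>j\<close>
  with probability \<open>x i j / a i\<close>, and let every \<open>j\<close> keep its heaviest proposer of nonnegative weight.
  This yields a matching of accepting vertices, so the maximum-weight matching is at least as heavy.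
  At a fixed \<open>j\<close> the proposals are independent with probabilities \<open>x i j\<close> of total at most 1,
  so for every set \<open>U\<close> some member of \<open>U\<close> proposes with probability at least
  \<open>1 - (\<Prod>i\<in>U. 1 - x i j) \<ge> (1 - 1/e) * (\<Sum>i\<in>U. x i j)\<close>; applied to the superlevel sets of the weights
  this bounds the expected weight kept at \<open>j\<close>. Given who accepts, an accepting value has conditional mean \<open>w i\<close>,
  which turns matched values into matched weights.
\<close>

section \<open>Hitting probabilities and the layer-cake bound\<close>

text \<open>Combine \<open>1 - t \<le> exp (- t)\<close> with the fact that the convex function
  \<open>exp\<close> lies below its chord on \<open>[-1, 0]\<close>; the slope of that chord is the
  constant \<open>1 - 1 / exp 1\<close>.\<close>

lemma one_minus_prod_ge:
  fixes z :: "'i \<Rightarrow> real"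
  assumes "finite T" and z: "\<And>i. i \<in> T \<Longrightarrow> 0 \<le> z i" and le1: "(\<Sum>i\<in>T. z i) \<le> 1"
  shows "(1 - 1 / exp 1) * (\<Sum>i\<in>T. z i) \<le> 1 - (\<Prod>i\<in>T. 1 - z i)"
proof -
  let ?s = "\<Sum>i\<in>T. z i"
  have s0: "0 \<le> ?s" using z by (rule sum_nonneg)
  have z1: "z i \<le> 1" if "i \<in> T" for i
    using member_le_sum[of i T z] assms that by fastforce
  have "(\<Prod>i\<in>T. 1 - z i) \<le> (\<Prod>i\<in>T. exp (- z i))"
  proof (rule prod_mono)
    fix i assume "i \<in> T"
    then show "0 \<le> 1 - z i \<and> 1 - z i \<le> exp (- z i)"
      using z1 exp_ge_add_one_self[of "- z i"] by auto
  qed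
  also have "\<dots> = exp (- ?s)"
    using \<open>finite T\<close> by (simp add: exp_sum[symmetric] sum_negf)
  \<comment> \<open>The point \<open>- ?s\<close> is the convex combination of \<open>0\<close> and
    \<open>-1\<close> with weights \<open>1 - ?s\<close> and \<open>?s\<close>, which is where a
    total of at most 1 enters.\<close>
  also have "\<dots> \<le> (1 - ?s) * exp 0 + ?s * exp (- 1)"
    using convex_onD[OF exp_convex, of ?s 0 "-1"] s0 le1 by simp
  finally show ?thesis
    by (simp add: exp_minus field_simps)
qed

text \<open>
  The discrete layer-cake argument: a bound on the probability of hitting every subset of \<open>T\<close>
  transfers to the expected largest weight hit, because subtracting the least positive weight
  from all positive weights lowers that largest weight by the same amount wherever the
  support is hit.
\<close>

lemma weighted_max_ge_of_hitting:
  fixes pr m :: "'g \<Rightarrow> real" and w z :: "'i \<Rightarrow> real"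
  assumes "finite \<Gamma>" "finite T"
    and pr: "\<And>g. g \<in> \<Gamma> \<Longrightarrow> 0 \<le> pr g"
    and hit: "\<And>U. U \<subseteq> T \<Longrightarrow>
      c * (\<Sum>i\<in>U. z i) \<le> (\<Sum>g\<in>\<Gamma>. pr g * of_bool (\<exists>i\<in>U. B g i))"
    and "\<And>i. i \<in> T \<Longrightarrow> 0 \<le> w i"
    and "\<And>g. g \<in> \<Gamma> \<Longrightarrow> 0 \<le> m g"
    and "\<And>g i. g \<in> \<Gamma> \<Longrightarrow> i \<in> T \<Longrightarrow> B g i \<Longrightarrow> w i \<le> m g"
  shows "c * (\<Sum>i\<in>T. w i * z i) \<le> (\<Sum>g\<in>\<Gamma>. pr g * m g)"
  using assms(5-7)
proof (induction "card {i\<in>T. w i \<noteq> 0}" arbitrary: w m rule: less_induct)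
  case less
  define U where "U = {i\<in>T. w i \<noteq> 0}"
  have U: "U \<subseteq> T" "finite U" using \<open>finite T\<close> by (auto simp: U_def)
  show ?case
  proof (cases "U = {}")
    case True
    then have "(\<Sum>i\<in>T. w i * z i) = 0" by (intro sum.neutral) (auto simp: U_def)
    then show ?thesis using pr less.prems by (simp add: sum_nonneg)
  next
    case False
    define d where "d = Min (w ` U)"
    have d_le: "d \<le> w i" if "i \<in> U" for i using that U by (simp add: d_def)
    obtain k where k: "k \<in> U" "w k = d"
      using Min_in[of "w ` U"] U False unfolding d_def
      by (metis (no_types) finite_imageI image_iff image_is_empty)
    have "0 < d" using k less.prems(1)[of k] by (auto simp: U_def)
    define w' where "w' i = (if i \<in> U then w i - d else w i)" for i
    define m' where "m' g = m g - d * of_bool (\<exists>i\<in>U. B g i)" for g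
    have m'0: "0 \<le> m' g" if "g \<in> \<Gamma>" for g
    proof (cases "\<exists>i\<in>U. B g i")
      case True
      then obtain i where "i \<in> U" "B g i" by blast
      then have "d \<le> m g" using d_le[of i] less.prems(3)[of g i] that U by force
      then show ?thesis using True by (simp add: m'_def)
    qed (use that less.prems(2) in \<open>simp add: m'_def\<close>)
    \<comment> \<open>The minimiser \<open>k\<close> gets weight 0 and no new vertex enters the
      support, so the induction measure drops strictly.\<close>
    have "{i\<in>T. w' i \<noteq> 0} \<subset> U"
      using k by (auto simp: w'_def U_def)
    then have "card {i\<in>T. w' i \<noteq> 0} < card U"
      using U by (simp add: psubset_card_mono)
    moreover have "0 \<le> w' i" if "i \<in> T" for i
      using that d_le less.prems(1) by (auto simp: w'_def)
    moreover note m'0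
    moreover have "w' i \<le> m' g" if "g \<in> \<Gamma>" "i \<in> T" "B g i" for g i
    proof (cases "i \<in> U")
      case True
      then have "\<exists>i\<in>U. B g i" using that by blast
      then show ?thesis using True that less.prems(3) by (simp add: w'_def m'_def)
    next
      case False
      then have "w' i = 0" using that by (simp add: w'_def U_def)
      then show ?thesis using m'0 that by simp
    qed
    ultimately have "c * (\<Sum>i\<in>T. w' i * z i) \<le> (\<Sum>g\<in>\<Gamma>. pr g * m' g)"
      unfolding U_def by (rule less.hyps)
    moreover have "(\<Sum>i\<in>T. w i * z i) = (\<Sum>i\<in>T. w' i * z i) + d * (\<Sum>i\<in>U. z i)"
    proof -
      have "(\<Sum>i\<in>T. w i * z i) = (\<Sum>i\<in>T. w' i * z i + (if i \<in> U then d * z i else 0))"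
        by (intro sum.cong) (auto simp: w'_def algebra_simps)
      also have "\<dots> = (\<Sum>i\<in>T. w' i * z i) + (\<Sum>i\<in>T \<inter> U. d * z i)"
        using \<open>finite T\<close> by (simp add: sum.distrib sum.inter_restrict)
      finally show ?thesis using U by (simp add: Int_absorb1 sum_distrib_left)
    qed
    moreover have "(\<Sum>g\<in>\<Gamma>. pr g * m g) =
        (\<Sum>g\<in>\<Gamma>. pr g * m' g) + d * (\<Sum>g\<in>\<Gamma>. pr g * of_bool (\<exists>i\<in>U. B g i))"
      by (simp add: m'_def sum_distrib_left sum.distrib[symmetric] algebra_simps)
    moreover have "d * (c * (\<Sum>i\<in>U. z i)) \<le> d * (\<Sum>g\<in>\<Gamma>. pr g * of_bool (\<exists>i\<in>U. B g i))"
      using hit[OF U(1)] \<open>0 < d\<close> by simp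
    ultimately show ?thesis by (simp add: algebra_simps)
  qed
qed

section \<open>Matchings from random proposals\<close>

text \<open>With \<open>f\<close> and \<open>g\<close> as the weights of accepting and rejecting,
  this splits the probability of a proposal profile according to the set \<open>A\<close> of
  accepting vertices.\<close>

lemma sum_Pow_prod_if:
  fixes f g :: "'i \<Rightarrow> 'c::comm_semiring_1"
  assumes "finite D"
  shows "(\<Sum>A\<in>Pow D. \<Prod>k\<in>D. if k \<in> A then f k else g k) = (\<Prod>k\<in>D. f k + g k)"
proof -
  have "(\<Prod>k\<in>D. if k \<in> A then f k else g k) = (\<Prod>k\<in>A. f k) * (\<Prod>k\<in>D - A. g k)"
    if "A \<in> Pow D" for A
  proof -
    have "D \<inter> A = A" "D \<inter> - A = D - A" using that by auto
    then show ?thesis using \<open>finite D\<close> by (simp add: prod.If_cases)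
  qed
  then show ?thesis using prod_add[OF assms, of f g] by simp
qed

text \<open>Each supply vertex keeps a heaviest proposer of nonnegative weight. Since
  \<open>g\<close> is a function, no demand vertex is kept twice. The inserted \<open>0\<close> is
  the contribution of a supply vertex that keeps nobody.\<close>

lemma bip_matching_of_proposals:
  fixes g :: "'i \<Rightarrow> 's option" and w :: "'i \<Rightarrow> real"
  assumes "finite D" "finite S" "A \<subseteq> D"
    and g: "\<And>i j. i \<in> D \<Longrightarrow> g i = Some j \<Longrightarrow> i \<in> A \<and> (i, j) \<in> E"
  obtains M where "bip_matching A S E M"
    and "(\<Sum>i\<in>fst ` M. w i) =
      (\<Sum>j\<in>S. Max (insert 0 (w ` {i\<in>D. 0 \<le> w i \<and> g i = Some j})))"
proof -
  define C where "C j = {i\<in>D. 0 \<le> w i \<and> g i = Some j}" for j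
  define m where "m j = Max (insert 0 (w ` C j))" for j
  define J where "J = {j\<in>S. C j \<noteq> {}}"
  have finC: "finite (C j)" for j using \<open>finite D\<close> by (simp add: C_def)
  have "\<exists>i\<in>C j. w i = m j" if "j \<in> J" for j
  proof -
    \<comment> \<open>All candidates in \<open>C j\<close> have nonnegative weight, so the inserted
      \<open>0\<close> does not exceed their maximum and some candidate attains
      \<open>m j\<close>.\<close>
    have "m j = max 0 (Max (w ` C j))"
      using that finC by (simp add: m_def J_def)
    moreover have "Max (w ` C j) \<in> w ` C j" using that finC by (simp add: J_def)
    ultimately show ?thesis by (auto simp: C_def)
  qed
  then obtain h where h: "\<And>j. j \<in> J \<Longrightarrow> h j \<in> C j \<and> w (h j) = m j" by metis
  have inj: "inj_on h J"
    by (rule inj_onI) (metis (mono_tags, lifting) C_def h mem_Collect_eq option.inject)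
  define M where "M = (\<lambda>j. (h j, j)) ` J"
  have "M \<subseteq> E \<inter> (A \<times> S)"
  proof
    fix e assume "e \<in> M"
    then obtain j where j: "j \<in> J" "e = (h j, j)" by (auto simp: M_def)
    then have "h j \<in> D" "g (h j) = Some j" using h by (auto simp: C_def)
    then show "e \<in> E \<inter> (A \<times> S)" using g j by (auto simp: J_def)
  qed
  moreover have "inj_on fst M" "inj_on snd M"
    using inj by (auto simp: M_def inj_on_def)
  ultimately have "bip_matching A S E M" by (simp add: bip_matching_def)
  moreover have "(\<Sum>i\<in>fst ` M. w i) = (\<Sum>j\<in>S. m j)"
  proof -
    have "fst ` M = h ` J" by (auto simp: M_def image_image)
    then have "(\<Sum>i\<in>fst ` M. w i) = (\<Sum>j\<in>J. m j)"
      using inj h by (simp add: sum.reindex)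
    also have "\<dots> = (\<Sum>j\<in>S. m j)"
      using \<open>finite S\<close> by (intro sum.mono_neutral_left) (auto simp: J_def m_def)
    finally show ?thesis .
  qed
  ultimately show thesis using that by (simp add: m_def C_def)
qed

text \<open>
  The coupling: \<open>J k True (Some j) = x k j\<close> is the probability that \<open>k\<close> accepts and proposes to \<open>j\<close>,
  \<open>J k True None\<close> that it accepts and makes no proposal, \<open>J k False None\<close> that it rejects.
  Distinct \<open>k\<close> are independent.
\<close>

lemma independent_acceptance_matching_ge:
  fixes E :: "('i \<times> 's) set" and a w y :: "'i \<Rightarrow> real" and W :: "'i set \<Rightarrow> real"
  assumes fin: "finite D" "finite S"
    and feas: "ex_ante_feasible D S E x y"
    and a: "\<And>i. i \<in> D \<Longrightarrow> y i \<le> a i" "\<And>i. i \<in> D \<Longrightarrow> a i \<le> 1"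
    and W: "\<And>A M. A \<subseteq> D \<Longrightarrow> bip_matching A S E M \<Longrightarrow> (\<Sum>i\<in>fst ` M. w i) \<le> W A"
  shows "(1 - 1 / exp 1) * (\<Sum>i\<in>D. w i * y i)
    \<le> (\<Sum>A\<in>Pow D. (\<Prod>k\<in>D. if k \<in> A then a k else 1 - a k) * W A)"
proof -
  define c :: real where "c = 1 - 1 / exp 1"
  have "0 \<le> c" by (simp add: c_def)
  \<comment> \<open>Extending \<open>x\<close> by zero off the edges lets all sums run over the
    whole of \<open>S\<close> or \<open>D\<close>; feasibility constrains the sign of
    \<open>x\<close> only on \<open>E\<close>.\<close>
  define z where "z i j = (if (i, j) \<in> E then x i j else 0)" for i j
  have z0: "0 \<le> z i j" for i j
    using feas by (auto simp: z_def ex_ante_feasible_def)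
  have y_eq: "y i = (\<Sum>j\<in>S. z i j)" if "i \<in> D" for i
    using feas that fin by (simp add: ex_ante_feasible_def z_def sum.inter_filter)
  have y0: "0 \<le> y i" if "i \<in> D" for i
    using that z0 by (simp add: y_eq sum_nonneg)
  have z_le: "(\<Sum>i\<in>D. z i j) \<le> 1" if "j \<in> S" for j
    using feas that fin by (simp add: ex_ante_feasible_def z_def sum.inter_filter)
  define Q where "Q = insert None (Some ` S)"
  have finQ: "finite Q" using fin by (simp add: Q_def)
  have sumQ: "(\<Sum>r\<in>Q. f r) = f None + (\<Sum>j\<in>S. f (Some j))" for f :: "'s option \<Rightarrow> real"
    using fin by (simp add: Q_def sum.reindex)
  \<comment> \<open>The surplus \<open>a k - y k\<close> of acceptance probability goes to making no
    proposal, so proposals to \<open>j\<close> have probability exactly \<open>z k j\<close>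
    although \<open>a k\<close> may exceed \<open>y k\<close>.\<close>
  define J where "J k b r = (case r of None \<Rightarrow> if b then a k - y k else 1 - a k
      | Some j \<Rightarrow> if b then z k j else 0)" for k b r
  have J0: "0 \<le> J k b r" if "k \<in> D" for k b r
    using a[OF that] z0 by (simp add: J_def split: option.split)
  have J_sum: "(\<Sum>r\<in>Q. J k b r) = (if b then a k else 1 - a k)" if "k \<in> D" for k b
    using that by (simp add: sumQ J_def y_eq)
  define q where "q k r = J k True r + J k False r" for k r
  have q0: "0 \<le> q k r" if "k \<in> D" for k r using J0[OF that] by (simp add: q_def)
  have q_sum: "(\<Sum>r\<in>Q. q k r) = 1" if "k \<in> D" for k
    using that by (simp add: q_def sum.distrib J_sum)
  have q_Some: "q k (Some j) = z k j" for k j by (simp add: q_def J_def)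
  define \<Gamma> where "\<Gamma> = PiE D (\<lambda>_. Q)"
  have fin\<Gamma>: "finite \<Gamma>" using fin finQ by (simp add: \<Gamma>_def finite_PiE)
  define pr where "pr g = (\<Prod>k\<in>D. q k (g k))" for g
  have pr0: "0 \<le> pr g" for g using q0 by (simp add: pr_def prod_nonneg)
  define T where "T = {i\<in>D. 0 \<le> w i}"
  have T: "T \<subseteq> D" "finite T" using fin by (auto simp: T_def)
  define m where "m g j = Max (insert 0 (w ` {i\<in>D. 0 \<le> w i \<and> g i = Some j}))"
    for g :: "'i \<Rightarrow> 's option" and j

  have hit: "c * (\<Sum>i\<in>U. z i j) \<le> (\<Sum>g\<in>\<Gamma>. pr g * of_bool (\<exists>i\<in>U. g i = Some j))"
    if "j \<in> S" "U \<subseteq> D" for j U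
  proof -
    have finU: "finite U" using that fin finite_subset by blast
    have "(\<Sum>i\<in>U. z i j) \<le> (\<Sum>i\<in>D. z i j)"
      using that fin z0 by (intro sum_mono2) auto
    then have "c * (\<Sum>i\<in>U. z i j) \<le> 1 - (\<Prod>i\<in>U. 1 - z i j)"
      unfolding c_def using one_minus_prod_ge[OF finU, of "\<lambda>i. z i j"] z0 z_le[OF that(1)] by simp
    moreover have "(\<Sum>g\<in>\<Gamma>. pr g) = 1"
      using prod_sum_PiE[of D "\<lambda>_. Q" q] fin finQ q_sum by (simp add: \<Gamma>_def pr_def)
    \<comment> \<open>The complementary event, that nobody in \<open>U\<close> proposes to
      \<open>j\<close>, is a conjunction of conditions on single coordinates, so its probability
      factors over \<open>D\<close>.\<close>
    moreover have "(\<Sum>g\<in>\<Gamma>. pr g * of_bool (\<not> (\<exists>i\<in>U. g i = Some j))) = (\<Prod>i\<in>U. 1 - z i j)"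
    proof -
      let ?f = "\<lambda>k r. q k r * of_bool (\<not> (k \<in> U \<and> r = Some j))"
      have "pr g * of_bool (\<not> (\<exists>i\<in>U. g i = Some j)) = (\<Prod>k\<in>D. ?f k (g k))" for g
      proof (cases "\<exists>i\<in>U. g i = Some j")
        case True
        then obtain i where i: "i \<in> U" "g i = Some j" by blast
        then have "(\<Prod>k\<in>D. ?f k (g k)) = 0"
          using that fin by (intro prod_zero) auto
        then show ?thesis using True by simp
      next
        case False
        then show ?thesis unfolding pr_def by (auto intro!: prod.cong)
      qed
      then have "(\<Sum>g\<in>\<Gamma>. pr g * of_bool (\<not> (\<exists>i\<in>U. g i = Some j))) = (\<Prod>k\<in>D. \<Sum>r\<in>Q. ?f k r)"
        using prod_sum_PiE[of D "\<lambda>_. Q" ?f] fin finQ by (simp add: \<Gamma>_def)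
      also have "\<dots> = (\<Prod>k\<in>D. if k \<in> U then 1 - z k j else 1)"
      proof (rule prod.cong[OF refl])
        fix k assume k: "k \<in> D"
        have "(\<Sum>r\<in>Q. q k r * of_bool (r \<noteq> Some j)) = (\<Sum>r\<in>Q. q k r) - q k (Some j)"
        proof -
          have "(\<Sum>r\<in>Q. q k r * of_bool (r \<noteq> Some j)) = (\<Sum>r\<in>Q - {Some j}. q k r)"
            using finQ by (intro sum.mono_neutral_cong_right) auto
          also have "\<dots> = (\<Sum>r\<in>Q. q k r) - q k (Some j)"
            using finQ that by (subst sum_diff1) (auto simp: Q_def)
          finally show ?thesis .
        qed
        then show "(\<Sum>r\<in>Q. ?f k r) = (if k \<in> U then 1 - z k j else 1)"
          using k q_sum q_Some by simp
      qed
      also have "\<dots> = (\<Prod>i\<in>U. 1 - z i j)"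
        using fin that by (simp add: prod.inter_restrict[symmetric] Int_absorb1)
      finally show ?thesis .
    qed
    moreover have "(\<Sum>g\<in>\<Gamma>. pr g) = (\<Sum>g\<in>\<Gamma>. pr g * of_bool (\<exists>i\<in>U. g i = Some j))
        + (\<Sum>g\<in>\<Gamma>. pr g * of_bool (\<not> (\<exists>i\<in>U. g i = Some j)))"
      unfolding sum.distrib[symmetric] by (intro sum.cong) auto
    ultimately show ?thesis by linarith
  qed

  have per_supply: "c * (\<Sum>i\<in>T. w i * z i j) \<le> (\<Sum>g\<in>\<Gamma>. pr g * m g j)" if "j \<in> S" for j
  proof (rule weighted_max_ge_of_hitting[OF fin\<Gamma> T(2) pr0])
    show "c * (\<Sum>i\<in>U. z i j) \<le> (\<Sum>g\<in>\<Gamma>. pr g * of_bool (\<exists>i\<in>U. g i = Some j))"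
      if "U \<subseteq> T" for U
      using that T hit[OF \<open>j \<in> S\<close>] by blast
  qed (use fin in \<open>auto simp: m_def T_def\<close>)

  \<comment> \<open>Conditional values can be negative; as \<open>y\<close> is nonnegative,
    discarding such vertices only increases the sum.\<close>
  have "(\<Sum>i\<in>D. w i * y i) \<le> (\<Sum>i\<in>T. w i * y i)"
  proof -
    have "(\<Sum>i\<in>D. w i * y i) = (\<Sum>i\<in>T. w i * y i) + (\<Sum>i\<in>D - T. w i * y i)"
      using T fin by (subst sum.subset_diff[of T D]) auto
    moreover have "(\<Sum>i\<in>D - T. w i * y i) \<le> 0"
      using y0 by (intro sum_nonpos) (auto simp: T_def mult_nonpos_nonneg)
    ultimately show ?thesis by simp
  qed
  also have "\<dots> = (\<Sum>j\<in>S. \<Sum>i\<in>T. w i * z i j)"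
    using T by (subst sum.swap) (auto intro!: sum.cong simp: y_eq sum_distrib_left)
  finally have "c * (\<Sum>i\<in>D. w i * y i) \<le> c * (\<Sum>j\<in>S. \<Sum>i\<in>T. w i * z i j)"
    using \<open>0 \<le> c\<close> by (rule mult_left_mono)
  also have "\<dots> \<le> (\<Sum>j\<in>S. \<Sum>g\<in>\<Gamma>. pr g * m g j)"
    using per_supply by (subst sum_distrib_left) (rule sum_mono)
  also have "\<dots> = (\<Sum>g\<in>\<Gamma>. pr g * (\<Sum>j\<in>S. m g j))"
    by (subst sum.swap) (simp add: sum_distrib_left)
  \<comment> \<open>The accepting set is reintroduced here: the marginal law of the proposals
    becomes the joint law of proposals and acceptances.\<close>
  also have "\<dots> = (\<Sum>g\<in>\<Gamma>. \<Sum>A\<in>Pow D. (\<Prod>k\<in>D. J k (k \<in> A) (g k)) * (\<Sum>j\<in>S. m g j))"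
  proof (rule sum.cong[OF refl])
    fix g
    have "pr g = (\<Sum>A\<in>Pow D. \<Prod>k\<in>D. if k \<in> A then J k True (g k) else J k False (g k))"
      unfolding pr_def q_def by (rule sum_Pow_prod_if[OF fin(1), symmetric])
    also have "\<dots> = (\<Sum>A\<in>Pow D. \<Prod>k\<in>D. J k (k \<in> A) (g k))"
      by (intro sum.cong prod.cong) auto
    finally show "pr g * (\<Sum>j\<in>S. m g j) =
        (\<Sum>A\<in>Pow D. (\<Prod>k\<in>D. J k (k \<in> A) (g k)) * (\<Sum>j\<in>S. m g j))"
      by (simp add: sum_distrib_right)
  qed
  also have "\<dots> \<le> (\<Sum>g\<in>\<Gamma>. \<Sum>A\<in>Pow D. (\<Prod>k\<in>D. J k (k \<in> A) (g k)) * W A)"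
  proof (intro sum_mono)
    fix g A assume A: "A \<in> Pow D"
    show "(\<Prod>k\<in>D. J k (k \<in> A) (g k)) * (\<Sum>j\<in>S. m g j) \<le> (\<Prod>k\<in>D. J k (k \<in> A) (g k)) * W A"
    \<comment> \<open>A profile of nonzero joint weight contains proposals only from members of
      \<open>A\<close> and along edges, hence yields a matching that \<open>W A\<close> dominates;
      all other profiles contribute 0 to both sides.\<close>
    proof (cases "(\<Prod>k\<in>D. J k (k \<in> A) (g k)) = 0")
      case False
      have "i \<in> A \<and> (i, j) \<in> E" if "i \<in> D" "g i = Some j" for i j
      proof -
        have "J i (i \<in> A) (g i) \<noteq> 0" using False fin that by auto
        then show ?thesis using that by (auto simp: J_def z_def split: if_splits)
      qed
      then obtain M where "bip_matching A S E M" "(\<Sum>i\<in>fst ` M. w i) = (\<Sum>j\<in>S. m g j)"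
        unfolding m_def using bip_matching_of_proposals[OF fin, of A g E w] A by blast
      then have "(\<Sum>j\<in>S. m g j) \<le> W A" using W[of A M] A by simp
      then show ?thesis using J0 by (intro mult_left_mono prod_nonneg) auto
    qed simp
  qed
  also have "\<dots> = (\<Sum>A\<in>Pow D. (\<Sum>g\<in>\<Gamma>. \<Prod>k\<in>D. J k (k \<in> A) (g k)) * W A)"
    by (subst sum.swap) (simp add: sum_distrib_right)
  \<comment> \<open>Since \<open>W A\<close> does not depend on the proposals, they can be summed
    out, leaving the product law of the accepting set.\<close>
  also have "\<dots> = (\<Sum>A\<in>Pow D. (\<Prod>k\<in>D. if k \<in> A then a k else 1 - a k) * W A)"
  proof (rule sum.cong[OF refl])
    fix A
    have "(\<Sum>g\<in>\<Gamma>. \<Prod>k\<in>D. J k (k \<in> A) (g k)) = (\<Prod>k\<in>D. \<Sum>r\<in>Q. J k (k \<in> A) r)"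
      unfolding \<Gamma>_def using fin finQ by (intro prod_sum_PiE[symmetric]) auto
    then show "(\<Sum>g\<in>\<Gamma>. \<Prod>k\<in>D. J k (k \<in> A) (g k)) * W A =
        (\<Prod>k\<in>D. if k \<in> A then a k else 1 - a k) * W A"
      using J_sum by simp
  qed
  finally show ?thesis by (simp add: c_def)
qed

section \<open>Threshold prices and values given acceptance\<close>

text \<open>Every real price below the supremum has \<open>cdf\<close> at most \<open>1 - q\<close>.
  At a finite threshold the left limit passes this bound to the open half-line below it, so the
  closed half-line, including any atom at the threshold, has mass at least \<open>q\<close>.\<close>

lemma threshold_acceptance_ge:
  assumes "real_distribution F" and "q \<le> 1"
  shows "q \<le> measure F {t. threshold F q \<le> ereal t}"
proof -
  interpret real_distribution F by fact
  define T where "T = {t. q \<le> 1 - cdf F t}"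
  have below: "cdf F t \<le> 1 - q" if lt: "ereal t < threshold F q" for t
  proof -
    obtain u where "u \<in> T" "t < u"
      using lt by (auto simp: threshold_def T_def less_Sup_iff)
    then show ?thesis using cdf_nondecreasing[of t u] by (simp add: T_def)
  qed
  show ?thesis
  proof (cases "threshold F q")
    case (real r)
    have "eventually (\<lambda>t. cdf F t \<le> 1 - q) (at_left r)"
      using below real by (auto simp: eventually_at_left_field intro!: exI[of _ "r - 1"])
    then have "measure F {..<r} \<le> 1 - q"
      by (intro tendsto_upperbound[OF cdf_at_left]) auto
    moreover have "measure F {r..} = 1 - measure F {..<r}"
      using prob_compl[of "{..<r}"] by (simp add: Compl_eq_Diff_UNIV[symmetric])
    moreover have "{t. threshold F q \<le> ereal t} = {r..}" using real by auto
    ultimately show ?thesis by simp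
  next
    \<comment> \<open>An infinite price is never accepted, but then the bound holds at every real
      price, and the limit 1 of \<open>cdf\<close> at infinity forces
      \<open>q \<le> 0\<close>.\<close>
    case PInf
    then have "1 \<le> 1 - q"
      using below by (intro tendsto_upperbound[OF cdf_lim_at_top_prob]) auto
    then show ?thesis using PInf by simp
  next
    case MInf
    then show ?thesis using assms prob_space by simp
  qed
qed

lemma cond_value_times_measure:
  assumes "real_distribution F"
  shows "cond_value F r * measure F {t. r \<le> ereal t} = (LINT t|F. t * of_bool (r \<le> ereal t))"
proof -
  interpret real_distribution F by fact
  have meas: "{t. r \<le> ereal t} \<in> sets F" by simp
  have eq: "(LINT t:{t. r \<le> ereal t}|F. t) = (LINT t|F. t * of_bool (r \<le> ereal t))"
    unfolding set_lebesgue_integral_def by (intro Bochner_Integration.integral_cong) auto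
  show ?thesis
  proof (cases "measure F {t. r \<le> ereal t} = 0")
    \<comment> \<open>On a null event the quotient defaults to 0, which agrees with the integral
      because its integrand vanishes almost everywhere.\<close>
    case True
    then have "AE t in F. t \<notin> {t. r \<le> ereal t}"
      using meas by (intro AE_not_in) (simp add: null_sets_def emeasure_eq_measure)
    then have "(LINT t|F. t * of_bool (r \<le> ereal t)) = 0"
      by (intro integral_eq_zero_AE) auto
    then show ?thesis using True by simp
  next
    case False
    then show ?thesis by (simp add: cond_value_def eq)
  qed
qed

text \<open>Fixing the accepting set imposes one condition on each independent value, so the
  expectation factors. Coordinate \<open>i\<close> contributes its conditional value times its
  acceptance probability; every other coordinate contributes the probability of its own
  decision.\<close>

lemma (in prob_space) expectation_value_on_accepting:
  fixes v :: "'i \<Rightarrow> 'a \<Rightarrow> real" and p :: "'i \<Rightarrow> ereal"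
  assumes fin: "finite D" and indep: "indep_vars (\<lambda>_. borel) v D"
    and int: "integrable M (v i)"
    and i: "i \<in> A" "A \<subseteq> D"
  defines "F \<equiv> \<lambda>k. distr M borel (v k)"
  defines "a \<equiv> \<lambda>k. measure (F k) {t. p k \<le> ereal t}"
  shows "integrable M (\<lambda>\<omega>. v i \<omega> * of_bool (accepting D p (\<lambda>k. v k \<omega>) = A))" (is ?int)
    and "expectation (\<lambda>\<omega>. v i \<omega> * of_bool (accepting D p (\<lambda>k. v k \<omega>) = A)) =
      cond_value (F i) (p i) * (\<Prod>k\<in>D. if k \<in> A then a k else 1 - a k)" (is ?eq)
proof -
  \<comment> \<open>The factor of coordinate \<open>k\<close>: the indicator that \<open>k\<close>
    decides as \<open>A\<close> prescribes, with the value itself multiplied in at \<open>i\<close>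
    only.\<close>
  define Y where "Y k t = (if k = i then t else 1) * of_bool ((p k \<le> ereal t) = (k \<in> A))"
    for k and t :: real
  have rv[measurable]: "random_variable borel (v k)" if "k \<in> D" for k
    using indep that by (simp add: indep_vars_def)
  have dist: "real_distribution (F k)" if "k \<in> D" for k
    unfolding F_def using rv[OF that] by (rule real_distribution_distr)
  have Y_meas[measurable]: "Y k \<in> borel_measurable borel" for k
    unfolding Y_def by measurable
  have indepY: "indep_vars (\<lambda>_. borel) (\<lambda>k \<omega>. Y k (v k \<omega>)) D"
    by (rule indep_vars_compose2[OF indep]) simp
  have intY: "integrable M (\<lambda>\<omega>. Y k (v k \<omega>))" if "k \<in> D" for k
  proof (cases "k = i")
    case True
    have "integrable M (\<lambda>\<omega>. Y i (v i \<omega>))"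
      using i rv by (intro Bochner_Integration.integrable_bound[OF int]) (auto simp: Y_def)
    then show ?thesis using True by simp
  next
    case False
    then show ?thesis
      using that by (intro integrable_const_bound[where B = 1]) (auto simp: Y_def)
  qed
  have prodY: "v i \<omega> * of_bool (accepting D p (\<lambda>k. v k \<omega>) = A) = (\<Prod>k\<in>D. Y k (v k \<omega>))" for \<omega>
  proof -
    have "(\<Prod>k\<in>D. Y k (v k \<omega>)) = v i \<omega> * (\<Prod>k\<in>D. of_bool ((p k \<le> ereal (v k \<omega>)) = (k \<in> A)))"
    proof -
      have "(\<Prod>k\<in>D. Y k (v k \<omega>)) = (\<Prod>k\<in>D. if k = i then v i \<omega> else 1) *
          (\<Prod>k\<in>D. of_bool ((p k \<le> ereal (v k \<omega>)) = (k \<in> A)))"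
        unfolding prod.distrib[symmetric] by (intro prod.cong) (auto simp: Y_def)
      then show ?thesis using fin i by auto
    qed
    moreover have "(\<Prod>k\<in>D. of_bool ((p k \<le> ereal (v k \<omega>)) = (k \<in> A))) =
        (of_bool (accepting D p (\<lambda>k. v k \<omega>) = A) :: real)"
    proof (cases "accepting D p (\<lambda>k. v k \<omega>) = A")
      case True
      then show ?thesis by (auto simp: accepting_def intro!: prod.neutral)
    next
      case False
      then have "\<exists>k\<in>D. (p k \<le> ereal (v k \<omega>)) \<noteq> (k \<in> A)"
        using i by (auto simp: accepting_def)
      then show ?thesis using False fin by (auto intro!: prod_zero)
    qed
    ultimately show ?thesis by simp
  qed
  show ?int
    unfolding prodY using fin indepY intY by (rule indep_vars_integrable)
  have EY: "expectation (\<lambda>\<omega>. Y k (v k \<omega>)) =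
      (if k = i then cond_value (F i) (p i) else 1) * (if k \<in> A then a k else 1 - a k)"
    if k: "k \<in> D" for k
  proof -
    interpret Fk: real_distribution "F k" using dist[OF k] .
    have E: "expectation (\<lambda>\<omega>. Y k (v k \<omega>)) = (LINT t|F k. Y k t)"
      unfolding F_def using rv[OF k] by (simp add: integral_distr)
    show ?thesis
    proof (cases "k = i")
      case True
      then have "(LINT t|F k. Y k t) = (LINT t|F i. t * of_bool (p i \<le> ereal t))"
        using i by (simp add: Y_def)
      also have "\<dots> = cond_value (F i) (p i) * a i"
        unfolding a_def using cond_value_times_measure dist i by (metis subsetD)
      finally show ?thesis using E True i by simp
    next
      case False
      let ?B = "{t. p k \<le> ereal t}"
      have B: "?B \<in> sets (F k)" by simp
      have "(LINT t|F k. Y k t) = (LINT t|F k. indicator (if k \<in> A then ?B else UNIV - ?B) t)"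
        using False by (intro Bochner_Integration.integral_cong) (auto simp: Y_def indicator_def)
      also have "\<dots> = (if k \<in> A then a k else 1 - a k)"
        using B Fk.prob_compl[OF B] by (simp add: a_def)
      finally show ?thesis using E False by simp
    qed
  qed
  have "expectation (\<lambda>\<omega>. \<Prod>k\<in>D. Y k (v k \<omega>)) = (\<Prod>k\<in>D. expectation (\<lambda>\<omega>. Y k (v k \<omega>)))"
    using fin indepY intY by (rule indep_vars_lebesgue_integral)
  also have "\<dots> = (\<Prod>k\<in>D. if k = i then cond_value (F i) (p i) else 1) *
      (\<Prod>k\<in>D. if k \<in> A then a k else 1 - a k)"
    by (simp add: EY prod.distrib)
  finally show ?eq
    unfolding prodY using fin i by auto
qed

section \<open>Expected efficiency of the policy\<close>

theorem mainTheorem12: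
  fixes D :: "'i set" and S :: "'s set" and E :: "('i \<times> 's) set"
    and F :: "'i \<Rightarrow> real measure" and P :: "'w measure" and v :: "'i \<Rightarrow> 'w \<Rightarrow> real"
    and x :: "'i \<Rightarrow> 's \<Rightarrow> real" and y :: "'i \<Rightarrow> real" and EAR :: real
    and p :: "'i \<Rightarrow> ereal" and mu :: "'i set \<Rightarrow> ('i \<times> 's) set"
  assumes graph: "finite D" "finite S" "E \<subseteq> D \<times> S"
    and prob: "prob_space P"
    and indep: "prob_space.indep_vars P (\<lambda>_. borel) v D"
    and dist: "\<And>i. i \<in> D \<Longrightarrow> distr P borel (v i) = F i"
    and mean: "\<And>i. i \<in> D \<Longrightarrow> integrable (F i) (\<lambda>t. t)"
    and opt: "ex_ante_optimal F D S E x y"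
    and EAR: "EAR = ex_ante_objective F D y"
    and price: "\<And>i. i \<in> D \<Longrightarrow> p i = threshold (F i) (y i)"
    and matching: "\<And>A. A \<subseteq> D \<Longrightarrow>
      max_vertex_weighted_matching A S E (\<lambda>i. cond_value (F i) (p i)) (mu A)"
  shows "demand_efficiency P v D p mu \<ge> (1 - 1 / exp 1) * EAR"
proof -
  interpret prob_space P by fact
  define w where "w i = cond_value (F i) (p i)" for i
  define a where "a i = measure (F i) {t. p i \<le> ereal t}" for i
  have rv: "random_variable borel (v i)" if "i \<in> D" for i
    using indep that by (simp add: indep_vars_def)
  have distF: "real_distribution (F i)" if "i \<in> D" for i
    using rv[OF that] dist[OF that] real_distribution_distr by metis
  have int: "integrable P (v i)" if "i \<in> D" for i
    using mean[OF that] rv[OF that] by (simp add: dist[OF that, symmetric] integrable_distr_eq)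
  have feas: "ex_ante_feasible D S E x y"
    using opt by (simp add: ex_ante_optimal_def)
  have a_ge: "y i \<le> a i" if "i \<in> D" for i
    unfolding a_def price[OF that]
    using feas that by (intro threshold_acceptance_ge distF) (auto simp: ex_ante_feasible_def)
  have a_le: "a i \<le> 1" if "i \<in> D" for i
    using distF[OF that] by (simp add: a_def real_distribution_def prob_space.prob_le_1)
  define pr where "pr A = (\<Prod>k\<in>D. if k \<in> A then a k else 1 - a k)" for A
  define acc where "acc \<omega> = accepting D p (\<lambda>k. v k \<omega>)" for \<omega>
  have acc_D: "acc \<omega> \<in> Pow D" for \<omega> by (auto simp: acc_def accepting_def)
  have mu: "fst ` mu A \<subseteq> A" if "A \<subseteq> D" for A
    using matching[OF that] by (auto simp: max_vertex_weighted_matching_def bip_matching_def)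
  have on_acc: "integrable P (\<lambda>\<omega>. v i \<omega> * of_bool (acc \<omega> = A))"
    "expectation (\<lambda>\<omega>. v i \<omega> * of_bool (acc \<omega> = A)) = w i * pr A"
    if "A \<subseteq> D" "i \<in> A" for A i
  proof -
    have "i \<in> D" using that by auto
    note * = expectation_value_on_accepting[OF graph(1) indep int[OF \<open>i \<in> D\<close>] that(2,1), of p]
    show "integrable P (\<lambda>\<omega>. v i \<omega> * of_bool (acc \<omega> = A))"
      using *(1) by (simp add: acc_def)
    have "(\<Prod>k\<in>D. if k \<in> A then measure (distr P borel (v k)) {t. p k \<le> ereal t}
        else 1 - measure (distr P borel (v k)) {t. p k \<le> ereal t}) = pr A"
      unfolding pr_def a_def by (intro prod.cong) (auto simp: dist)
    then show "expectation (\<lambda>\<omega>. v i \<omega> * of_bool (acc \<omega> = A)) = w i * pr A"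
      using *(2) by (simp add: acc_def w_def dist[OF \<open>i \<in> D\<close>])
  qed
  \<comment> \<open>Pointwise, exactly one \<open>A\<close> is the accepting set, and
    \<open>mu A\<close> matches only members of \<open>A\<close>. Splitting by \<open>A\<close>
    makes the matching deterministic in each term, so expectations can be taken vertex by
    vertex.\<close>
  have "(\<Sum>i\<in>D. v i \<omega> * of_bool (p i \<le> ereal (v i \<omega>) \<and> i \<in> fst ` mu (acc \<omega>))) =
      (\<Sum>A\<in>Pow D. \<Sum>i\<in>fst ` mu A. v i \<omega> * of_bool (acc \<omega> = A))" for \<omega>
  proof -
    have "(\<Sum>i\<in>D. v i \<omega> * of_bool (p i \<le> ereal (v i \<omega>) \<and> i \<in> fst ` mu (acc \<omega>))) =
        (\<Sum>i\<in>fst ` mu (acc \<omega>). v i \<omega>)"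
      using mu[of "acc \<omega>"] acc_D[of \<omega>] graph(1)
      by (intro sum.mono_neutral_cong_right) (auto simp: acc_def accepting_def)
    also have "\<dots> = (\<Sum>A\<in>Pow D. if A = acc \<omega> then \<Sum>i\<in>fst ` mu A. v i \<omega> else 0)"
      using acc_D[of \<omega>] graph(1) by simp
    also have "\<dots> = (\<Sum>A\<in>Pow D. \<Sum>i\<in>fst ` mu A. v i \<omega> * of_bool (acc \<omega> = A))"
      by (intro sum.cong) auto
    finally show ?thesis .
  qed
  then have "demand_efficiency P v D p mu =
      expectation (\<lambda>\<omega>. \<Sum>A\<in>Pow D. \<Sum>i\<in>fst ` mu A. v i \<omega> * of_bool (acc \<omega> = A))"
    by (simp add: demand_efficiency_def acc_def)
  also have "\<dots> = (\<Sum>A\<in>Pow D. \<Sum>i\<in>fst ` mu A. w i * pr A)"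
  proof (subst Bochner_Integration.integral_sum)
    show "integrable P (\<lambda>\<omega>. \<Sum>i\<in>fst ` mu A. v i \<omega> * of_bool (acc \<omega> = A))" if "A \<in> Pow D" for A
      using on_acc(1)[of A] mu[of A] that by (intro Bochner_Integration.integrable_sum) blast
    have "expectation (\<lambda>\<omega>. \<Sum>i\<in>fst ` mu A. v i \<omega> * of_bool (acc \<omega> = A)) =
        (\<Sum>i\<in>fst ` mu A. w i * pr A)" if "A \<in> Pow D" for A
    proof -
      have "expectation (\<lambda>\<omega>. \<Sum>i\<in>fst ` mu A. v i \<omega> * of_bool (acc \<omega> = A)) =
          (\<Sum>i\<in>fst ` mu A. expectation (\<lambda>\<omega>. v i \<omega> * of_bool (acc \<omega> = A)))"
        using on_acc(1)[of A] mu[of A] that by (intro Bochner_Integration.integral_sum) blast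
      also have "\<dots> = (\<Sum>i\<in>fst ` mu A. w i * pr A)"
        using on_acc(2)[of A] mu[of A] that by (intro sum.cong refl) blast
      finally show ?thesis .
    qed
    then show "(\<Sum>A\<in>Pow D. expectation (\<lambda>\<omega>. \<Sum>i\<in>fst ` mu A. v i \<omega> * of_bool (acc \<omega> = A))) =
        (\<Sum>A\<in>Pow D. \<Sum>i\<in>fst ` mu A. w i * pr A)"
      by (rule sum.cong[OF refl])
  qed
  also have "\<dots> = (\<Sum>A\<in>Pow D. pr A * (\<Sum>i\<in>fst ` mu A. w i))"
    by (simp add: sum_distrib_left mult.commute)
  \<comment> \<open>Here \<open>W A\<close> is the weight of \<open>mu A\<close>; maximality of
    \<open>mu A\<close> is exactly the domination required of \<open>W\<close>.\<close>
  also have "\<dots> \<ge> (1 - 1 / exp 1) * (\<Sum>i\<in>D. w i * y i)"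
    unfolding pr_def
  proof (rule independent_acceptance_matching_ge[OF graph(1,2) feas a_ge a_le])
    show "(\<Sum>i\<in>fst ` M. w i) \<le> (\<Sum>i\<in>fst ` mu A. w i)"
      if "A \<subseteq> D" "bip_matching A S E M" for A M
      using matching[OF that(1)] that(2) by (simp add: max_vertex_weighted_matching_def w_def)
  qed
  also have "(\<Sum>i\<in>D. w i * y i) = EAR"
    by (simp add: EAR ex_ante_objective_def w_def price)
  finally show ?thesis .
qed

end
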